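(* Let $V$ be a DQSO on $S$ with hereditary coefficients $(P_{ij,k})_{i,j,k\in\mathbb{N}}$. Assume that there exists a sequence $\{j_n\}_{n\geq 1}\subset\mathbb{N}$ such that for all $n,m\in\mathbb{N}$ $$P_{j_nj_m,k}=0\qquad\text{for all } k\in\mathbb{N}\setminus\{n,m\}.$$ Then $V:S\to S$ is surjective.
   Context: $\mathbb{N}=\{1,2,3,\dots\}$ and $S=\{\mathbf{x}=(x_i)_{i\in\mathbb{N}}\in\mathbb{R}^{\mathbb{N}}: x_i\ge 0 \text{ for all } i,\ \sum_{i\in\mathbb{N}}x_i=1\}$. A (infinite dimensional) discrete quadratic stochastic operator (DQSO) on $S$ is a map $V:S\to S$ of the form $(V(\mathbf{x}))_k=\sum_{i,j\in\mathbb{N}}P_{ij,k}x_ix_j$, $k\in\mathbb{N}$, where the hereditary coefficients satisfy $P_{ij,k}\ge 0$, $P_{ij,k}=P_{ji,k}$ and $\sum_{k\in\mathbb{N}}P_{ij,k}=1$ for all $i,j,k\in\mathbb{N}$. *)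

theory Defs
  imports "HOL-Analysis.Analysis"
begin

text \<open>
  The countable index set is the type \<^typ>\<open>nat\<close>, so indices start at \<open>0\<close> instead of \<open>1\<close>;
  this only relabels the coordinates.
\<close>

definition prob_seqs :: "(nat \<Rightarrow> real) set" where
  "prob_seqs = {x. (\<forall>i. 0 \<le> x i) \<and> (x has_sum 1) UNIV}"

text \<open>The coefficient \<open>P\<^sub>i\<^sub>j\<^sub>,\<^sub>k\<close> is written \<open>P i j k\<close>.\<close>

definition hereditary :: "(nat \<Rightarrow> nat \<Rightarrow> nat \<Rightarrow> real) \<Rightarrow> bool" where
  "hereditary P \<longleftrightarrow>
     (\<forall>i j k. 0 \<le> P i j k) \<and>
     (\<forall>i j k. P i j k = P j i k) \<and>
     (\<forall>i j. (P i j has_sum 1) UNIV)"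

text \<open>
  Only the restriction of \<open>V\<close> to \<^const>\<open>prob_seqs\<close> is constrained. There the double series
  converges, since its nonnegative terms are dominated by \<open>x i * x j\<close>.
\<close>

definition dqso ::
    "(nat \<Rightarrow> nat \<Rightarrow> nat \<Rightarrow> real) \<Rightarrow> ((nat \<Rightarrow> real) \<Rightarrow> (nat \<Rightarrow> real)) \<Rightarrow> bool" where
  "dqso P V \<longleftrightarrow>
     hereditary P \<and>
     V \<in> prob_seqs \<rightarrow> prob_seqs \<and>
     (\<forall>x\<in>prob_seqs. \<forall>k. V x k = (\<Sum>\<^sub>\<infinity>(i, j)\<in>UNIV. P i j k * x i * x j))"

end

theory Submission
  imports Defs
begin

text \<open>
  On the face of sequences supported on \<open>range j\<close>, written in the coordinates
  \<open>y n = x (j n)\<close>, the operator takes the Volterra form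
  \<open>V\<^sub>k(y) = y\<^sub>k * (\<Sum>m. b\<^sub>k\<^sub>m * y\<^sub>m)\<close>, where \<open>b \<ge> 0\<close> and
  \<open>b\<^sub>k\<^sub>m + b\<^sub>m\<^sub>k = 2\<close>: the offspring of \<open>j\<^sub>n\<close> and \<open>j\<^sub>m\<close> is of type \<open>n\<close> or \<open>m\<close>
  (in particular \<open>j\<close> is injective, the offspring of \<open>j\<^sub>n\<close> and \<open>j\<^sub>n\<close> being \<open>n\<close>). It
  therefore suffices that such an operator hits every target \<open>z\<close>.

  In finitely many coordinates, with all \<open>z\<^sub>k > 0\<close>, a preimage is found as a point \<open>y\<close> of
  the simplex that minimises the relative entropy of \<open>z\<close> with respect to \<open>V(y)\<close>, that is,
  maximises the product of the \<open>V\<^sub>k(y)\<close> to the powers \<open>z\<^sub>k\<close>. All \<open>y\<^sub>k\<close> and all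
  \<open>w\<^sub>k = (b y)\<^sub>k\<close> are positive there, so moving towards another point \<open>d\<close> of the simplex
  cannot increase the logarithm to first order:
  \<open>\<Sum>k. z\<^sub>k * (d\<^sub>k / y\<^sub>k + (b d)\<^sub>k / w\<^sub>k) \<le> 2\<close>. The direction to take is
  \<open>d = u / s\<close> with \<open>u\<^sub>k = z\<^sub>k / w\<^sub>k\<close> and \<open>s = \<Sum>k. u\<^sub>k\<close>. Because the
  quadratic form of \<open>b\<close> is the square of the sum of the coordinates, the inequality becomes
  \<open>Q / s + s \<le> 2\<close> with \<open>Q = \<Sum>k. z\<^sub>k\<^sup>2 / V\<^sub>k(y)\<close>, hence
  \<open>Q \<le> s * (2 - s) \<le> 1\<close>. But \<open>Q - 1\<close> is the chi-square distance of \<open>z\<close> from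
  \<open>V(y)\<close>, so \<open>V(y) = z\<close>. This is \<open>volterra_onto_positive\<close>; coordinates with
  \<open>z\<^sub>k = 0\<close> are dealt with by putting \<open>y\<^sub>k = 0\<close>.

  For infinitely many coordinates, truncations of \<open>z\<close> have finite preimages, and a subsequence
  of these converges coordinatewise. No mass escapes, because the square of the mass of a preimage
  on a set of coordinates is at most the mass of its image there (\<open>tail_square_le\<close>). Keeping
  only finitely many of the nonnegative terms of each \<open>V\<^sub>k\<close> before taking the limit gives
  \<open>V(y) \<le> z\<close>, as in Fatou's lemma (\<open>volterra_subsolution\<close>). Both sides have
  total mass one, so they are equal.
\<close>

section \<open>Volterra operators on finite simplices\<close>

definition simplex_on :: "'a set \<Rightarrow> ('a \<Rightarrow> real) set" where
  "simplex_on F = {y. (\<forall>k. 0 \<le> y k) \<and> (\<forall>k. k \<notin> F \<longrightarrow> y k = 0) \<and> sum y F = 1}"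

text \<open>
  Equivalently, \<open>b k m = 1 + a k m\<close> for a skew-symmetric \<open>a\<close> with entries in \<open>[-1, 1]\<close>,
  which is the usual parametrisation of Volterra operators.
\<close>

definition complementary :: "('a \<Rightarrow> 'a \<Rightarrow> real) \<Rightarrow> bool" where
  "complementary b \<longleftrightarrow> (\<forall>k m. 0 \<le> b k m \<and> b k m + b m k = 2)"

text \<open>
  The Volterra operator of \<open>b\<close> maps \<open>y\<close> to \<open>\<lambda>k. y k * rate b F y k\<close>.
\<close>

definition rate :: "('a \<Rightarrow> 'a \<Rightarrow> real) \<Rightarrow> 'a set \<Rightarrow> ('a \<Rightarrow> real) \<Rightarrow> 'a \<Rightarrow> real" where
  "rate b F y k = (\<Sum>m\<in>F. b k m * y m)"

lemma simplex_onD: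
  assumes "y \<in> simplex_on F"
  shows "0 \<le> y k" "k \<notin> F \<Longrightarrow> y k = 0" "sum y F = 1"
  using assms by (auto simp: simplex_on_def)

lemma complementaryD:
  assumes "complementary b"
  shows "0 \<le> b k m" "b k m + b m k = 2" "b k k = 1"
proof -
  show "0 \<le> b k m" "b k m + b m k = 2"
    using assms by (auto simp: complementary_def)
  have "b k k + b k k = 2"
    using assms unfolding complementary_def by blast
  then show "b k k = 1" by simp
qed

text \<open>
  Averaging the form with its transpose replaces every coefficient by \<open>1\<close>. For \<open>u\<close> in the
  simplex this says that the Volterra operator preserves total mass.
\<close>

lemma complementary_quadratic_form:
  assumes "complementary b"
  shows "(\<Sum>k\<in>F. u k * rate b F u k) = (sum u F)\<^sup>2"
proof -
  let ?S = "\<Sum>k\<in>F. u k * rate b F u k"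
  have S: "?S = (\<Sum>k\<in>F. \<Sum>m\<in>F. b k m * (u k * u m))"
    by (simp add: rate_def sum_distrib_left mult_ac)
  also have "\<dots> = (\<Sum>m\<in>F. \<Sum>k\<in>F. b k m * (u k * u m))"
    by (rule sum.swap)
  finally have S': "?S = (\<Sum>k\<in>F. \<Sum>m\<in>F. b m k * (u k * u m))"
    by (simp add: mult_ac)
  have "2 * ?S = (\<Sum>k\<in>F. \<Sum>m\<in>F. (b k m + b m k) * (u k * u m))"
    using S S' by (simp add: sum.distrib distrib_right)
  also have "\<dots> = 2 * (sum u F * sum u F)"
    unfolding complementaryD(2)[OF assms] sum_product
    by (simp add: sum_distrib_left)
  finally show ?thesis by (simp add: power2_eq_square)
qed

text \<open>
  The diagonal coefficient is \<open>1\<close>, so the rates cannot vanish at interior points of the simplex.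
\<close>

lemma rate_ge_self:
  assumes "complementary b" "finite F" "\<And>m. m \<in> F \<Longrightarrow> 0 \<le> y m" "k \<in> F"
  shows "y k \<le> rate b F y k"
proof -
  have "b k k * y k \<le> (\<Sum>m\<in>F. b k m * y m)"
    using assms by (intro member_le_sum) (auto intro: mult_nonneg_nonneg complementaryD(1))
  then show ?thesis
    using complementaryD(3)[OF assms(1)] by (simp add: rate_def)
qed

lemma compact_unit_cube: "compact {y :: 'a \<Rightarrow> real. \<forall>k. y k \<in> {0..1}}"
proof -
  have "compactin (product_topology (\<lambda>_. euclidean) UNIV)
      (PiE (UNIV :: 'a set) (\<lambda>_. {0..1 :: real}))"
    by (simp add: compactin_PiE)
  moreover have "PiE (UNIV :: 'a set) (\<lambda>_. {0..1 :: real}) = {y. \<forall>k. y k \<in> {0..1}}"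
    by (auto simp: PiE_UNIV_domain)
  ultimately show ?thesis
    by (simp add: euclidean_product_topology)
qed

lemma compact_simplex_on:
  assumes "finite F"
  shows "compact (simplex_on F)"
proof -
  have "closed {y :: 'a \<Rightarrow> real. (\<forall>k. k \<notin> F \<longrightarrow> y k = 0) \<and> sum y F = 1}"
    by (intro closed_Collect_conj closed_Collect_all closed_Collect_imp closed_Collect_eq
        continuous_intros open_Collect_const continuous_on_product_coordinates)
  moreover have "simplex_on F = {y. \<forall>k. y k \<in> {0..1}}
      \<inter> {y. (\<forall>k. k \<notin> F \<longrightarrow> y k = 0) \<and> sum y F = 1}"
    (is "_ = ?R")
  proof
    show "simplex_on F \<subseteq> ?R"
    proof
      fix y assume y: "y \<in> simplex_on F"
      have "y k \<le> 1" for k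
      proof (cases "k \<in> F")
        case True
        then have "y k \<le> sum y F"
          using assms by (intro member_le_sum) (auto simp: simplex_onD(1)[OF y])
        then show ?thesis using simplex_onD(3)[OF y] by simp
      qed (simp add: simplex_onD(2)[OF y])
      then show "y \<in> ?R" using y by (auto simp: simplex_on_def)
    qed
  qed (auto simp: simplex_on_def)
  ultimately show ?thesis
    by (simp only: compact_Int_closed[OF compact_unit_cube])
qed

text \<open>
  Up to a constant depending on \<open>z\<close>, the negative logarithm is the relative entropy of \<open>z\<close>
  with respect to the image of \<open>y\<close>. The product form is used because, for positive \<open>z\<close>, it
  is continuous up to the boundary of the simplex, where the logarithm is infinite.
\<close>

definition likelihood ::
    "('a \<Rightarrow> 'a \<Rightarrow> real) \<Rightarrow> 'a set \<Rightarrow> ('a \<Rightarrow> real) \<Rightarrow> ('a \<Rightarrow> real) \<Rightarrow> real" where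
  "likelihood b F z y = (\<Prod>k\<in>F. (y k * rate b F y k) powr z k)"

text \<open>
  A maximiser exists by compactness. It is an interior point: the likelihood vanishes where some
  coordinate does, and is positive at \<open>z\<close>.
\<close>

lemma exists_max_likelihood:
  assumes "complementary b" "finite F" "z \<in> simplex_on F" "\<And>k. k \<in> F \<Longrightarrow> 0 < z k"
  obtains y where "y \<in> simplex_on F" "\<And>k. k \<in> F \<Longrightarrow> 0 < y k"
    "\<And>x. x \<in> simplex_on F \<Longrightarrow> likelihood b F z x \<le> likelihood b F z y"
proof -
  have nonneg: "0 \<le> y k * rate b F y k" if "y \<in> simplex_on F" for y k
    using simplex_onD(1)[OF that] complementaryD(1)[OF assms(1)]
    by (auto simp: rate_def intro!: mult_nonneg_nonneg sum_nonneg)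
  have "continuous_on (simplex_on F) (likelihood b F z)"
    unfolding likelihood_def
  proof (intro continuous_on_prod continuous_on_powr')
    show "continuous_on (simplex_on F) (\<lambda>y. y k * rate b F y k)" for k
      unfolding rate_def
      by (intro continuous_intros continuous_on_subset[OF continuous_on_product_coordinates]
          subset_UNIV)
  qed (use assms(4) nonneg in \<open>auto intro: continuous_intros\<close>)
  then obtain y where y: "y \<in> simplex_on F"
    and max: "\<And>x. x \<in> simplex_on F \<Longrightarrow> likelihood b F z x \<le> likelihood b F z y"
    using continuous_attains_sup[OF compact_simplex_on[OF assms(2)]] assms(3) by blast
  have "0 < likelihood b F z z"
    unfolding likelihood_def
  proof (intro prod_pos)
    fix k assume "k \<in> F"
    then have "0 < rate b F z k"
      using rate_ge_self[OF assms(1,2), of z k] assms(4) simplex_onD(1)[OF assms(3)] by force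
    then show "0 < (z k * rate b F z k) powr z k"
      using assms(4)[OF \<open>k \<in> F\<close>] by simp
  qed
  then have "likelihood b F z y \<noteq> 0"
    using max[OF assms(3)] by simp
  then have "y k \<noteq> 0" if "k \<in> F" for k
    using assms(2) that by (auto simp: likelihood_def)
  then have "0 < y k" if "k \<in> F" for k
    using that simplex_onD(1)[OF y, of k] by force
  then show thesis using that y max by blast
qed

text \<open>
  The first-order condition for the log-likelihood along the segment from \<open>y\<close> to \<open>d\<close>. Both
  \<open>y k\<close> and \<open>rate b F y k\<close> are affine along it, and the two terms that the endpoint \<open>y\<close>
  contributes to the derivative add up to \<open>2 * sum z F = 2\<close>.
\<close>

lemma max_likelihood_variation:
  assumes "complementary b" "finite F"
    and y: "y \<in> simplex_on F" "\<And>k. k \<in> F \<Longrightarrow> 0 < y k"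
    and max: "\<And>x. x \<in> simplex_on F \<Longrightarrow> likelihood b F z x \<le> likelihood b F z y"
    and d: "d \<in> simplex_on F"
    and z: "z \<in> simplex_on F"
  shows "(\<Sum>k\<in>F. z k * (d k / y k + rate b F d k / rate b F y k)) \<le> 2"
proof -
  define x where "x t k = y k + t * (d k - y k)" for t k
  define h where "h t = (\<Sum>k\<in>F. z k * (ln (y k + t * (d k - y k))
      + ln (rate b F y k + t * (rate b F d k - rate b F y k))))" for t
  define D where "D = (\<Sum>k\<in>F. z k * ((d k - y k) / y k
      + (rate b F d k - rate b F y k) / rate b F y k))"
  have rate_pos: "0 < rate b F x k" if "\<And>m. m \<in> F \<Longrightarrow> 0 < x m" "k \<in> F" for x k
    using rate_ge_self[OF assms(1,2), of x k] that by force
  have rate_x: "rate b F (x t) k = rate b F y k + t * (rate b F d k - rate b F y k)" for t k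
    by (simp add: rate_def x_def sum_distrib_left sum.distrib sum_subtractf algebra_simps)
  have likelihood_x: "likelihood b F z (x t) = exp (h t)" if pos: "\<And>k. k \<in> F \<Longrightarrow> 0 < x t k" for t
  proof -
    have "(x t k * rate b F (x t) k) powr z k = exp (z k * (ln (x t k) + ln (rate b F (x t) k)))"
      if k: "k \<in> F" for k
    proof -
      have "0 < x t k" "0 < rate b F (x t) k"
        using pos rate_pos[of "x t" k] k by auto
      then show ?thesis by (simp add: powr_def ln_mult)
    qed
    then show ?thesis
      using assms(2) by (simp add: likelihood_def h_def exp_sum rate_x x_def)
  qed
  have "(h has_real_derivative D) (at 0)"
    unfolding h_def D_def
  proof (rule DERIV_sum)
    fix k assume "k \<in> F"
    then have "0 < y k" "0 < rate b F y k" using y(2) rate_pos by auto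
    then show "((\<lambda>t. z k * (ln (y k + t * (d k - y k))
          + ln (rate b F y k + t * (rate b F d k - rate b F y k)))) has_real_derivative
        z k * ((d k - y k) / y k + (rate b F d k - rate b F y k) / rate b F y k)) (at 0)"
      by (auto intro!: derivative_eq_intros simp: divide_inverse)
  qed
  have "\<not> 0 < D"
  proof
    assume "0 < D"
    with \<open>(h has_real_derivative D) (at 0)\<close>
    obtain e where e: "0 < e" "\<And>t. 0 < t \<Longrightarrow> t < e \<Longrightarrow> h 0 < h (0 + t)"
      using DERIV_pos_inc_right by blast
    define t where "t = min (e / 2) (1 / 2)"
    have t: "0 < t" "t < e" "t < 1" using e(1) by (auto simp: t_def)
    have x: "x t k = (1 - t) * y k + t * d k" for k
      by (simp add: x_def algebra_simps)
    have x0: "x 0 = y" by (auto simp: x_def)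
    have pos: "0 < x t k" if "k \<in> F" for k
      using y(2)[OF that] simplex_onD(1)[OF d, of k] t by (simp add: x add_pos_nonneg)
    have "x t \<in> simplex_on F"
      using t simplex_onD[OF y(1)] simplex_onD[OF d]
      by (auto simp: simplex_on_def x sum.distrib simp flip: sum_distrib_left)
    from max[OF this] have "exp (h t) \<le> exp (h 0)"
      using likelihood_x[of t] likelihood_x[of 0] pos y(2) by (simp add: x0)
    with e(2)[OF t(1,2)] show False by simp
  qed
  moreover have "D = (\<Sum>k\<in>F. z k * (d k / y k + rate b F d k / rate b F y k)) - 2 * sum z F"
    unfolding D_def sum_distrib_left sum_subtractf[symmetric]
    using y(2) rate_pos[of y]
    by (intro sum.cong refl) (force simp: field_simps)
  ultimately show ?thesis using simplex_onD(3)[OF z] by simp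
qed

lemma chi_square_eq:
  fixes z v :: "'a \<Rightarrow> real"
  assumes "finite F" "\<And>k. k \<in> F \<Longrightarrow> 0 < v k" "sum v F = 1" "sum z F = 1"
  shows "(\<Sum>k\<in>F. (z k)\<^sup>2 / v k) = 1 + (\<Sum>k\<in>F. (z k - v k)\<^sup>2 / v k)"
proof -
  have "(\<Sum>k\<in>F. (z k - v k)\<^sup>2 / v k) = (\<Sum>k\<in>F. (z k)\<^sup>2 / v k - 2 * z k + v k)"
  proof (intro sum.cong refl)
    fix k assume "k \<in> F"
    then show "(z k - v k)\<^sup>2 / v k = (z k)\<^sup>2 / v k - 2 * z k + v k"
      using assms(2)[of k] by (simp add: field_simps power2_eq_square)
  qed
  also have "\<dots> = (\<Sum>k\<in>F. (z k)\<^sup>2 / v k) - 2 * sum z F + sum v F"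
    by (simp add: sum.distrib sum_subtractf sum_distrib_left)
  finally show ?thesis using assms by simp
qed

text \<open>
  The maximiser \<open>y\<close> is the preimage. If \<open>y\<close> is to map to \<open>z\<close>, then \<open>u k = z k / w k\<close>
  must be \<open>y k\<close>, and so the first-order condition is tested in the direction of the normalised
  \<open>u\<close>. With this choice the terms with \<open>rate b F d\<close> form the quadratic form of \<open>b\<close> and
  collapse to \<open>s\<close>.
\<close>

lemma volterra_onto_positive:
  assumes "complementary b" "finite F" "z \<in> simplex_on F" "\<And>k. k \<in> F \<Longrightarrow> 0 < z k"
  obtains y where "y \<in> simplex_on F" "\<And>k. k \<in> F \<Longrightarrow> y k * rate b F y k = z k"
proof -
  obtain y where y: "y \<in> simplex_on F" "\<And>k. k \<in> F \<Longrightarrow> 0 < y k"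
    and max: "\<And>x. x \<in> simplex_on F \<Longrightarrow> likelihood b F z x \<le> likelihood b F z y"
    using exists_max_likelihood[OF assms] by blast
  define w where "w = rate b F y"
  have w: "0 < w k" if "k \<in> F" for k
    using rate_ge_self[OF assms(1,2), of y k] y(2) that by (force simp: w_def)
  define u where "u k = (if k \<in> F then z k / w k else 0)" for k
  define s where "s = sum u F"
  have u: "0 < u k" if "k \<in> F" for k
    using w assms(4) that by (simp add: u_def)
  have "F \<noteq> {}" using simplex_onD(3)[OF assms(3)] by auto
  then have s: "0 < s"
    unfolding s_def using u assms(2) by (intro sum_pos) auto
  define d where "d k = u k / s" for k
  have d: "d \<in> simplex_on F"
  proof -
    have "0 \<le> d k" for k
      using less_imp_le[OF divide_pos_pos[OF u s], of k]
      by (cases "k \<in> F") (auto simp: d_def u_def)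
    moreover have "sum d F = sum u F / s"
      by (simp add: d_def sum_divide_distrib)
    ultimately show ?thesis
      using s by (auto simp: simplex_on_def d_def s_def u_def)
  qed
  define Q where "Q = (\<Sum>k\<in>F. (z k)\<^sup>2 / (y k * w k))"
  have "2 \<ge> (\<Sum>k\<in>F. z k * (d k / y k + rate b F d k / w k))"
    using max_likelihood_variation[OF assms(1,2) y max d assms(3)] by (simp add: w_def)
  also have "(\<Sum>k\<in>F. z k * (d k / y k + rate b F d k / w k))
      = (\<Sum>k\<in>F. (z k)\<^sup>2 / (y k * w k) / s + s * (d k * rate b F d k))"
    using s by (intro sum.cong refl) (auto simp: d_def u_def field_simps power2_eq_square)
  also have "\<dots> = Q / s + s * (\<Sum>k\<in>F. d k * rate b F d k)"
    by (simp add: Q_def sum.distrib sum_distrib_left sum_divide_distrib)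
  also have "\<dots> = Q / s + s"
    using complementary_quadratic_form[OF assms(1), of d F] simplex_onD(3)[OF d] by simp
  finally have "Q + s * s \<le> 2 * s"
    using s by (simp add: field_simps)
  \<comment> \<open>\<open>Q \<le> 2 * s - s\<^sup>2 = 1 - (s - 1)\<^sup>2\<close>\<close>
  then have "Q \<le> 1"
    using zero_le_square[of "s - 1"] by (simp add: algebra_simps)
  moreover have "Q = 1 + (\<Sum>k\<in>F. (z k - y k * w k)\<^sup>2 / (y k * w k))"
    unfolding Q_def
  proof (rule chi_square_eq[OF assms(2)])
    show "(\<Sum>k\<in>F. y k * w k) = 1"
      using complementary_quadratic_form[OF assms(1), of y F] simplex_onD(3)[OF y(1)]
      by (simp add: w_def)
  qed (use y w simplex_onD(3)[OF assms(3)] in auto)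
  ultimately have "(\<Sum>k\<in>F. (z k - y k * w k)\<^sup>2 / (y k * w k)) \<le> 0"
    by simp
  moreover have nonneg: "0 \<le> (z k - y k * w k)\<^sup>2 / (y k * w k)" if "k \<in> F" for k
    using y(2)[OF that] w[OF that] by simp
  ultimately have "(\<Sum>k\<in>F. (z k - y k * w k)\<^sup>2 / (y k * w k)) = 0"
    by (meson order_antisym sum_nonneg)
  then have "\<forall>k\<in>F. (z k - y k * w k)\<^sup>2 / (y k * w k) = 0"
    using assms(2) nonneg by (simp add: sum_nonneg_eq_0_iff)
  then have "y k * rate b F y k = z k" if "k \<in> F" for k
    using y(2)[OF that] w[OF that] that by (force simp: w_def)
  then show thesis using that y(1) by blast
qed

text \<open>
  Volterra operators map every face of the simplex into itself, so \<open>z\<close> can be hit from the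
  face spanned by its support.
\<close>

lemma volterra_onto:
  assumes "complementary b" "finite F" "z \<in> simplex_on F"
  obtains y where "y \<in> simplex_on F" "\<And>k. k \<in> F \<Longrightarrow> y k * rate b F y k = z k"
proof -
  define G where "G = {k \<in> F. z k \<noteq> 0}"
  have G: "G \<subseteq> F" "finite G" using assms(2) by (auto simp: G_def)
  have "sum z G = sum z F"
    using assms(2) by (intro sum.mono_neutral_left) (auto simp: G_def)
  then have "z \<in> simplex_on G"
    using assms(3) by (auto simp: simplex_on_def G_def)
  moreover have "0 < z k" if "k \<in> G" for k
    using that simplex_onD(1)[OF assms(3), of k] by (force simp: G_def)
  ultimately obtain y where y: "y \<in> simplex_on G"
    and eq: "\<And>k. k \<in> G \<Longrightarrow> y k * rate b G y k = z k"
    using volterra_onto_positive[OF assms(1) G(2)] by blast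
  have "sum y F = sum y G"
    using assms(2) G simplex_onD(2)[OF y] by (intro sum.mono_neutral_right) auto
  then have "y \<in> simplex_on F"
    using y G by (auto simp: simplex_on_def)
  moreover have "rate b F y k = rate b G y k" for k
    unfolding rate_def using assms(2) G simplex_onD(2)[OF y]
    by (intro sum.mono_neutral_right) auto
  then have "y k * rate b F y k = z k" if "k \<in> F" for k
    using eq[of k] that simplex_onD(2)[OF y, of k] by (cases "k \<in> G") (auto simp: G_def)
  ultimately show thesis using that by blast
qed

section \<open>Passage to infinitely many coordinates\<close>

text \<open>
  The pairs with both members in \<open>H\<close> contribute exactly \<open>(sum y H)\<^sup>2\<close> to the image of
  \<open>H\<close>, and the other pairs contribute nonnegative amounts. With \<open>H\<close> a tail of the index set,
  this controls the tails of preimages uniformly.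
\<close>

lemma tail_square_le:
  assumes "complementary b" "finite F" "H \<subseteq> F" "y \<in> simplex_on F"
    and "\<And>k. k \<in> F \<Longrightarrow> y k * rate b F y k = z k"
  shows "(sum y H)\<^sup>2 \<le> sum z H"
proof -
  have "(sum y H)\<^sup>2 = (\<Sum>k\<in>H. y k * rate b H y k)"
    by (simp add: complementary_quadratic_form[OF assms(1)])
  also have "\<dots> \<le> (\<Sum>k\<in>H. y k * rate b F y k)"
    unfolding rate_def using assms(2,3) simplex_onD(1)[OF assms(4)] complementaryD(1)[OF assms(1)]
    by (intro sum_mono mult_left_mono sum_mono2) auto
  also have "\<dots> = sum z H"
    using assms(3,5) by (intro sum.cong) auto
  finally show ?thesis .
qed

lemma prob_seqs_partial_sums:
  assumes "z \<in> prob_seqs"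
  shows "(\<lambda>n. \<Sum>k\<le>n. z k) \<longlonglongrightarrow> 1" "(\<Sum>k\<le>n. z k) \<le> 1"
proof -
  have nonneg: "0 \<le> z k" and hs: "(z has_sum 1) UNIV" for k
    using assms by (auto simp: prob_seqs_def)
  show "(\<lambda>n. \<Sum>k\<le>n. z k) \<longlonglongrightarrow> 1"
    using has_sum_imp_sums[OF hs] by (simp add: sums_def_le)
  show "(\<Sum>k\<le>n. z k) \<le> 1"
    by (rule has_sum_mono'[OF has_sum_finite hs]) (auto simp: nonneg)
qed

text \<open>
  The inequality is stated for the partial sums of the rate; it is the form in which it survives
  a coordinatewise limit, and it yields the bound on the full series of nonnegative terms.
\<close>

lemma volterra_subsolution:
  assumes b: "complementary b" and z: "z \<in> prob_seqs"
  obtains y where "y \<in> prob_seqs" "\<And>k N. y k * rate b {..N} y k \<le> z k"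
proof -
  have z_nonneg: "0 \<le> z k" for k using z by (auto simp: prob_seqs_def)
  define t where "t n = 1 - (\<Sum>k\<le>n. z k)" for n
  have t: "0 \<le> t n" "t \<longlonglongrightarrow> 0" for n
    using prob_seqs_partial_sums(2)[OF z] tendsto_diff[OF tendsto_const prob_seqs_partial_sums(1)[OF z], of 1]
    by (auto simp: t_def[abs_def])
  \<comment> \<open>The cut-off mass is moved to coordinate \<open>0\<close>, so that no tail of \<open>z\<close> starting
    at a positive index increases.\<close>
  define zn where "zn n k = (if k \<le> n then z k + (if k = 0 then t n else 0) else 0)" for n k
  have "zn n \<in> simplex_on {..n}" for n
  proof -
    have "sum (zn n) {..n} = (\<Sum>k\<le>n. z k) + (\<Sum>k\<le>n. if k = 0 then t n else 0)"
      by (simp add: zn_def sum.distrib)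
    also have "\<dots> = 1" by (simp add: t_def)
    finally show ?thesis
      using z_nonneg t(1) by (auto simp: simplex_on_def zn_def)
  qed
  then have "\<exists>y. y \<in> simplex_on {..n} \<and> (\<forall>k\<in>{..n}. y k * rate b {..n} y k = zn n k)" for n
    using volterra_onto[OF b] by (metis finite_atMost)
  then obtain Y where Y: "\<And>n. Y n \<in> simplex_on {..n}"
    and eq: "\<And>n k. k \<le> n \<Longrightarrow> Y n k * rate b {..n} (Y n) k = zn n k"
    by (metis atMost_iff)
  note Y_nonneg = simplex_onD(1)[OF Y]
  have "Y n k \<le> 1" for n k
  proof (cases "k \<le> n")
    case True
    then have "Y n k \<le> sum (Y n) {..n}"
      by (intro member_le_sum) (auto simp: Y_nonneg)
    then show ?thesis using simplex_onD(3)[OF Y] by simp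
  qed (simp add: simplex_onD(2)[OF Y])
  then have "\<forall>n. Y n \<in> {y. \<forall>k. y k \<in> {0..1}}"
    by (simp add: Y_nonneg)
  then obtain y r where r: "strict_mono (r :: nat \<Rightarrow> nat)" and "(Y \<circ> r) \<longlonglongrightarrow> y"
    using compact_imp_seq_compact[OF compact_unit_cube] unfolding seq_compact_def by metis
  have lim: "(\<lambda>n. Y (r n) k) \<longlonglongrightarrow> y k" for k
    using continuous_on_tendsto_compose[OF continuous_on_product_coordinates[of k]
        \<open>(Y \<circ> r) \<longlonglongrightarrow> y\<close>] by simp
  have y_nonneg: "0 \<le> y k" for k
    using lim by (rule LIMSEQ_le_const) (simp add: Y_nonneg)
  have le_r: "n \<le> r n" for n using seq_suble[OF r] .
  have t_r: "(\<lambda>n. t (r n)) \<longlonglongrightarrow> 0"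
    using LIMSEQ_subseq_LIMSEQ[OF t(2) r] by (simp add: o_def)

  \<comment> \<open>For a fixed range \<open>{..N}\<close> the left-hand side is continuous in \<open>Y (r n)\<close>.\<close>
  have sub: "y k * rate b {..N} y k \<le> z k" for k N
  proof (rule LIMSEQ_le)
    show "(\<lambda>n. Y (r n) k * rate b {..N} (Y (r n)) k) \<longlonglongrightarrow> y k * rate b {..N} y k"
      unfolding rate_def by (intro tendsto_intros lim)
    show "(\<lambda>n. z k + t (r n)) \<longlonglongrightarrow> z k"
      using tendsto_add[OF tendsto_const t_r, of "z k"] by simp
    show "\<exists>M. \<forall>n\<ge>M. Y (r n) k * rate b {..N} (Y (r n)) k \<le> z k + t (r n)"
    proof (intro exI allI impI)
      fix n assume "max k N \<le> n"
      then have kN: "k \<le> r n" "N \<le> r n" using le_r[of n] by auto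
      have "Y (r n) k * rate b {..N} (Y (r n)) k \<le> Y (r n) k * rate b {..r n} (Y (r n)) k"
        unfolding rate_def using kN complementaryD(1)[OF b]
        by (intro mult_left_mono sum_mono2) (auto simp: Y_nonneg)
      also have "\<dots> \<le> z k + t (r n)"
        using eq[OF kN(1)] kN(1) t(1)[of "r n"] by (simp add: zn_def)
      finally show "Y (r n) k * rate b {..N} (Y (r n)) k \<le> z k + t (r n)" .
    qed
  qed

  \<comment> \<open>The limit has mass one, since the mass of \<open>Y n\<close> beyond \<open>N\<close> is bounded
    independently of \<open>n\<close>.\<close>
  have tail: "(1 - (\<Sum>k\<le>N. Y n k))\<^sup>2 \<le> t N" if "N \<le> n" for n N
  proof -
    have split: "sum f {..n} = sum f {..N} + sum f {N<..n}" for f :: "nat \<Rightarrow> real"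
      using that by (subst sum.union_disjoint[symmetric]) (auto intro: sum.cong)
    have "1 - (\<Sum>k\<le>N. Y n k) = sum (Y n) {N<..n}"
      using split[of "Y n"] simplex_onD(3)[OF Y, of n] by simp
    moreover have "{N<..n} \<subseteq> {..n}" by auto
    ultimately have "(1 - (\<Sum>k\<le>N. Y n k))\<^sup>2 \<le> sum (zn n) {N<..n}"
      using tail_square_le[OF b finite_atMost _ Y eq, of "{N<..n}" n] by auto
    also have "\<dots> = sum z {N<..n}"
      by (intro sum.cong) (auto simp: zn_def)
    also have "\<dots> \<le> t N"
      using split[of z] t(1)[of n] by (simp add: t_def)
    finally show ?thesis .
  qed
  have sq: "(1 - (\<Sum>k\<le>N. y k))\<^sup>2 \<le> t N" for N
  proof (rule LIMSEQ_le_const2)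
    show "(\<lambda>n. (1 - (\<Sum>k\<le>N. Y (r n) k))\<^sup>2) \<longlonglongrightarrow> (1 - (\<Sum>k\<le>N. y k))\<^sup>2"
      by (intro tendsto_intros lim)
    show "\<exists>M. \<forall>n\<ge>M. (1 - (\<Sum>k\<le>N. Y (r n) k))\<^sup>2 \<le> t N"
      using tail le_r order_trans by blast
  qed
  have "(\<lambda>N. (1 - (\<Sum>k\<le>N. y k))\<^sup>2) \<longlonglongrightarrow> 0"
    by (rule tendsto_sandwich[OF _ _ tendsto_const t(2)]) (auto simp: sq)
  then have "(\<lambda>N. 1 - (\<Sum>k\<le>N. y k)) \<longlonglongrightarrow> 0"
    by simp
  then have "(\<lambda>N. \<Sum>k\<le>N. y k) \<longlonglongrightarrow> 1"
    using tendsto_diff[OF tendsto_const, of _ 0 sequentially 1] by force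
  then have "(y has_sum 1) UNIV"
    by (intro sums_nonneg_imp_has_sum y_nonneg) (simp add: sums_def_le)
  then have "y \<in> prob_seqs"
    using y_nonneg by (simp add: prob_seqs_def)
  then show thesis using that sub by blast
qed

lemma prob_seqs_eqI:
  assumes "x \<in> prob_seqs" "z \<in> prob_seqs" "\<And>k. x k \<le> z k"
  shows "x = z"
proof -
  have "((\<lambda>k. z k - x k) has_sum 0) UNIV"
    using has_sum_add[of z UNIV 1 "\<lambda>k. - x k" "-1"] assms(1,2)
    unfolding prob_seqs_def by (simp add: has_sum_uminus)
  then have "z k - x k = 0" for k
    by (rule nonneg_has_sum_le_0D) (use assms(3) in auto)
  then show ?thesis by (auto simp: fun_eq_iff)
qed

section \<open>The face of the simplex spanned by the distinguished indices\<close>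

text \<open>
  The factor \<open>2\<close> collects the contributions of \<open>(k, m)\<close> and \<open>(m, k)\<close> to coordinate \<open>k\<close>.
\<close>

definition face_coeff ::
    "(nat \<Rightarrow> nat \<Rightarrow> nat \<Rightarrow> real) \<Rightarrow> (nat \<Rightarrow> nat) \<Rightarrow> nat \<Rightarrow> nat \<Rightarrow> real" where
  "face_coeff P j k m = (if m = k then 1 else 2 * P (j k) (j m) k)"

locale volterra_face =
  fixes P :: "nat \<Rightarrow> nat \<Rightarrow> nat \<Rightarrow> real" and j :: "nat \<Rightarrow> nat"
  assumes hereditary: "hereditary P"
    and vanish: "k \<noteq> n \<Longrightarrow> k \<noteq> m \<Longrightarrow> P (j n) (j m) k = 0"
begin

lemma face_sum: "(\<Sum>k\<in>{n, m}. P (j n) (j m) k) = 1"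
proof -
  have "(P (j n) (j m) has_sum 1) UNIV"
    using hereditary by (simp add: hereditary_def)
  moreover have "(P (j n) (j m) has_sum (\<Sum>k\<in>{n, m}. P (j n) (j m) k)) UNIV"
    by (rule has_sum_finite_neutralI) (auto simp: vanish)
  ultimately show ?thesis by (rule has_sum_unique[symmetric])
qed

lemma face_diag: "P (j n) (j n) n = 1"
  using face_sum[of n n] by simp

text \<open>
  If \<open>j n = j m\<close>, the coefficient of this index with itself would be concentrated both on
  \<open>n\<close> and on \<open>m\<close>.
\<close>

lemma inj_face: "inj j"
proof (rule injI, rule ccontr)
  fix n m assume "j n = j m" "n \<noteq> m"
  then show False using face_diag[of n] vanish[of n m m] by simp
qed

lemma complementary_face_coeff: "complementary (face_coeff P j)"
proof -
  have "P (j k) (j m) k + P (j m) (j k) m = 1" if "k \<noteq> m" for k m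
    using face_sum[of k m] hereditary that by (auto simp: hereditary_def)
  then show ?thesis
    using hereditary by (fastforce simp: complementary_def face_coeff_def hereditary_def)
qed

text \<open>
  This form separates the row \<open>n = k\<close> from the column \<open>m = k\<close>, the only pairs that reach
  coordinate \<open>k\<close>; on the diagonal the two halves add up to \<open>P (j k) (j k) k = 1\<close>.
\<close>

lemma face_coeff_split:
  "P (j n) (j m) k = (if n = k then face_coeff P j k m / 2 else 0)
     + (if m = k then face_coeff P j k n / 2 else 0)"
  using face_diag[of k] vanish[of k n m] hereditary
  by (auto simp: face_coeff_def hereditary_def)

lemma face_square_sum:
  assumes "k \<le> N"
  shows "(\<Sum>n\<le>N. \<Sum>m\<le>N. P (j n) (j m) k * y n * y m)
    = y k * rate (face_coeff P j) {..N} y k"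
proof -
  let ?b = "face_coeff P j k"
  have "(\<Sum>n\<le>N. \<Sum>m\<le>N. P (j n) (j m) k * y n * y m)
      = (\<Sum>n\<le>N. \<Sum>m\<le>N. (if n = k then ?b m / 2 * y n * y m else 0)
          + (if m = k then ?b n / 2 * y n * y m else 0))"
    by (intro sum.cong refl) (simp add: face_coeff_split distrib_right)
  also have "\<dots> = (\<Sum>m\<le>N. \<Sum>n\<le>N. if n = k then ?b m / 2 * y n * y m else 0)
        + (\<Sum>n\<le>N. \<Sum>m\<le>N. if m = k then ?b n / 2 * y n * y m else 0)"
    unfolding sum.distrib by (subst sum.swap) (rule refl)
  also have "\<dots> = (\<Sum>m\<le>N. ?b m / 2 * y k * y m) + (\<Sum>n\<le>N. ?b n / 2 * y n * y k)"
    using assms by simp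
  also have "\<dots> = (\<Sum>m\<le>N. y k * (?b m * y m))"
    unfolding sum.distrib[symmetric] by (intro sum.cong) (auto simp: field_simps)
  finally show ?thesis by (simp add: rate_def sum_distrib_left)
qed

text \<open>
  All terms are nonnegative, so it suffices to bound finite partial sums, and each of them is
  contained in a square \<open>{..N} \<times> {..N}\<close> in the coordinates of the face.
\<close>

lemma quadratic_series_on_face_le:
  assumes y: "\<And>n. 0 \<le> y n" and "0 \<le> c"
    and bound: "\<And>N. y k * rate (face_coeff P j) {..N} y k \<le> c"
    and x: "\<And>n. x (j n) = y n" "\<And>i. i \<notin> range j \<Longrightarrow> x i = 0"
  shows "(\<Sum>\<^sub>\<infinity>(i, i')\<in>UNIV. P i i' k * x i * x i') \<le> c"
proof -
  define f where "f = (\<lambda>(n, m). P (j n) (j m) k * y n * y m)"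
  have P: "0 \<le> P i i' k" for i i' using hereditary by (simp add: hereditary_def)
  have "(\<Sum>\<^sub>\<infinity>(i, i')\<in>UNIV. P i i' k * x i * x i')
      = (\<Sum>\<^sub>\<infinity>(i, i')\<in>range (map_prod j j). P i i' k * x i * x i')"
  proof (rule infsum_cong_neutral)
    fix p assume "p \<in> UNIV - range (map_prod j j)"
    then have "fst p \<notin> range j \<or> snd p \<notin> range j"
      by (cases p) (auto simp: map_prod_def image_def)
    then show "(case p of (i, i') \<Rightarrow> P i i' k * x i * x i') = 0"
      using x(2) by (cases p) auto
  qed auto
  also have "\<dots> = infsum f UNIV"
    by (subst infsum_reindex)
       (auto intro!: infsum_cong prod.inj_map inj_face simp: f_def x(1))
  also have "\<dots> \<le> c"
  proof (cases "f summable_on UNIV")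
    case True
    then show ?thesis
    proof (rule infsum_le_finite_sums)
      fix G :: "(nat \<times> nat) set"
      assume "finite G"
      \<comment> \<open>\<open>k\<close> is included because the sum over a square is a Volterra term only if
        \<open>k \<le> N\<close>.\<close>
      then obtain N where N: "fst ` G \<union> snd ` G \<union> {k} \<subseteq> {..N}"
        by (metis finite_Un finite_imageI finite.emptyI finite_insert finite_nat_iff_bounded_le)
      then have "G \<subseteq> {..N} \<times> {..N}" by force
      then have "sum f G \<le> sum f ({..N} \<times> {..N})"
        by (intro sum_mono2) (auto simp: f_def P y)
      also have "\<dots> = y k * rate (face_coeff P j) {..N} y k"
        using N by (simp add: f_def sum.cartesian_product[symmetric] face_square_sum)
      also have "\<dots> \<le> c" by (rule bound)
      finally show "sum f G \<le> c" .
    qed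
  qed (simp add: infsum_not_exists \<open>0 \<le> c\<close>)
  finally show ?thesis .
qed

lemma exists_face_point:
  assumes "y \<in> prob_seqs"
  obtains x where "x \<in> prob_seqs" "\<And>n. x (j n) = y n" "\<And>i. i \<notin> range j \<Longrightarrow> x i = 0"
proof
  let ?x = "\<lambda>i. if i \<in> range j then y (inv j i) else 0"
  show x: "?x (j n) = y n" for n by (simp add: inj_face)
  have "(y has_sum 1) UNIV" using assms by (simp add: prob_seqs_def)
  then have "(?x has_sum 1) (range j)"
    by (subst has_sum_reindex[OF inj_face]) (simp add: o_def inj_face)
  then have "(?x has_sum 1) UNIV"
    by (subst has_sum_cong_neutral[of "range j" UNIV]) auto
  then show "?x \<in> prob_seqs" using assms by (simp add: prob_seqs_def)
qed simp

end

theorem theorem3p5: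
  fixes P :: "nat \<Rightarrow> nat \<Rightarrow> nat \<Rightarrow> real"
    and V :: "(nat \<Rightarrow> real) \<Rightarrow> (nat \<Rightarrow> real)"
  assumes "dqso P V"
    and "\<exists>j :: nat \<Rightarrow> nat. \<forall>n m. \<forall>k \<in> UNIV - {n, m}. P (j n) (j m) k = 0"
  shows "V ` prob_seqs = prob_seqs"
proof
  show "V ` prob_seqs \<subseteq> prob_seqs"
    using assms(1) by (auto simp: dqso_def)
  show "prob_seqs \<subseteq> V ` prob_seqs"
  proof
    fix z assume z: "z \<in> prob_seqs"
    obtain j :: "nat \<Rightarrow> nat" where
      vanish: "\<And>n m k. k \<noteq> n \<Longrightarrow> k \<noteq> m \<Longrightarrow> P (j n) (j m) k = 0"
      using assms(2) by (metis DiffI UNIV_I empty_iff insert_iff)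
    interpret volterra_face P j
      by unfold_locales (use assms(1) vanish in \<open>auto simp: dqso_def\<close>)
    obtain y where y: "y \<in> prob_seqs"
      and sub: "\<And>k N. y k * rate (face_coeff P j) {..N} y k \<le> z k"
      using volterra_subsolution[OF complementary_face_coeff z] by blast
    obtain x where x: "x \<in> prob_seqs" "\<And>n. x (j n) = y n" "\<And>i. i \<notin> range j \<Longrightarrow> x i = 0"
      using exists_face_point[OF y] by blast
    have "V x k \<le> z k" for k
    proof -
      have "(\<Sum>\<^sub>\<infinity>(i, i')\<in>UNIV. P i i' k * x i * x i') \<le> z k"
      proof (rule quadratic_series_on_face_le[where y = y])
        show "0 \<le> y n" "0 \<le> z k" for n
          using y z by (auto simp: prob_seqs_def)
      qed (use sub x in auto)
      then show ?thesis
        using assms(1) x(1) by (simp add: dqso_def)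
    qed
    moreover have "V x \<in> prob_seqs"
      using assms(1) x(1) by (auto simp: dqso_def)
    ultimately have "V x = z"
      using prob_seqs_eqI z by blast
    then show "z \<in> V ` prob_seqs" using x(1) by blast
  qed
qed

end
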